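(* Let $p\in\mathbb{N}$ and real numbers $0\le\alpha\le\beta$ be fixed. For each $f\in C^*_\rho[0,\infty)$, $$\lim_{n\to\infty}\|\mathcal{L}^{(\alpha,\beta)}_{n,p}(f)-f\|_\rho=0.$$
   Context: $\mathbb{N}$ denotes the positive integers. For $n,p\in\mathbb{N}$, $0\le\alpha\le\beta$ and suitable $f:[0,\infty)\to\mathbb{R}$, the Baskakov-Schurer-Szász-Stancu operator is $$\mathcal{L}^{(\alpha,\beta)}_{n,p}(f,x)=(n+p)\sum_{k=0}^{\infty}b^k_{n,p}(x)\int_0^\infty s^k_{n,p}(t)\,f\left(\frac{nt+\alpha}{n+\beta}\right)dt,\qquad x\in[0,\infty),$$ where $b^k_{n,p}(x)=\binom{n+p+k-1}{k}\frac{x^k}{(1+x)^{n+p+k}}$ and $s^k_{n,p}(t)=e^{-(n+p)t}\frac{((n+p)t)^k}{k!}$; $\mathcal{L}^{(\alpha,\beta)}_{n,p}(f)$ denotes the function $x\mapsto\mathcal{L}^{(\alpha,\beta)}_{n,p}(f,x)$. Let $\rho(x)=1+x^2$. $C_\rho[0,\infty)$ is the space of continuous $f:[0,\infty)\to\mathbb{R}$ for which there is a constant $M_f$ with $|f(x)|\le M_f\,\rho(x)$ for all $x\ge0$. $C^*_\rho[0,\infty)$ is the subspace of those $f\in C_\rho[0,\infty)$ for which $\lim_{x\to\infty}f(x)/\rho(x)$ exists and is finite. The norm is $\|f\|_\rho=\sup_{x\in[0,\infty)}\frac{|f(x)|}{1+x^2}$. *)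

theory Defs
  imports "HOL-Analysis.Analysis"
begin

text \<open>
  Functions on \<open>[0,\<infinity>)\<close> are represented by total functions on the reals; every notion below depends
  only on the values on \<open>{0..}\<close> (for the operator this uses \<open>0 \<le> \<alpha>\<close> and \<open>0 \<le> \<beta>\<close>).
\<close>

text \<open>The truncated subtraction is harmless since \<open>n + p \<ge> 1\<close> in all uses.\<close>

definition baskakov_basis :: "nat \<Rightarrow> nat \<Rightarrow> nat \<Rightarrow> real \<Rightarrow> real" where
  "baskakov_basis n p k x =
     real ((n + p + k - 1) choose k) * (x ^ k / (1 + x) ^ (n + p + k))"

definition szasz_basis :: "nat \<Rightarrow> nat \<Rightarrow> nat \<Rightarrow> real \<Rightarrow> real" where
  "szasz_basis n p k t =
     exp (- (real (n + p) * t)) * ((real (n + p) * t) ^ k / fact k)"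

definition BSSS_operator ::
    "real \<Rightarrow> real \<Rightarrow> nat \<Rightarrow> nat \<Rightarrow> (real \<Rightarrow> real) \<Rightarrow> real \<Rightarrow> real" where
  "BSSS_operator \<alpha> \<beta> n p f x =
     real (n + p) *
     (\<Sum>k. baskakov_basis n p k x *
        (LINT t:{0..}|lborel. szasz_basis n p k t * f ((real n * t + \<alpha>) / (real n + \<beta>))))"

definition rho :: "real \<Rightarrow> real" where
  "rho x = 1 + x\<^sup>2"

definition C_rho :: "(real \<Rightarrow> real) set" where
  "C_rho = {f. continuous_on {0..} f \<and> (\<exists>M. \<forall>x\<ge>0. \<bar>f x\<bar> \<le> M * rho x)}"

definition C_rho_star :: "(real \<Rightarrow> real) set" where
  "C_rho_star = {f \<in> C_rho. \<exists>l. ((\<lambda>x. f x / rho x) \<longlongrightarrow> l) at_top}"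

text \<open>
  The supremum is taken in the extended reals, because a supremum in \<^typ>\<open>real\<close> is unspecified
  for unbounded sets. Here the value is \<open>\<infinity>\<close> in that case.
\<close>

definition rho_norm :: "(real \<Rightarrow> real) \<Rightarrow> ereal" where
  "rho_norm f = (SUP x\<in>{0..}. ereal (\<bar>f x\<bar> / (1 + x\<^sup>2)))"

end

theory Submission
  imports Defs "HOL-Probability.Distributions" "HOL-Real_Asymp.Real_Asymp"
begin

text \<open>
  The proof is a quantitative Korovkin argument. The operator \<open>L\<close> is positive and preserves constants,
  so an estimate
  \<open>\<bar>f t - f x\<bar> \<le> \<epsilon> * (1 + x\<^sup>2) + K * (t - x)\<^sup>2\<close> for all \<open>t, x \<ge> 0\<close>
  implies that the error of \<open>L\<close> at \<open>x\<close> is at most \<open>\<epsilon> * (1 + x\<^sup>2)\<close> plus \<open>K\<close> times the value at \<open>x\<close> of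
  \<open>L\<close> applied to \<open>\<lambda>t. (t - x)\<^sup>2\<close>. That value is a quadratic polynomial in \<open>x\<close> whose coefficients tend
  to \<open>0\<close>, hence at most a null sequence times \<open>1 + x\<^sup>2\<close>
  (\<open>BSSS_operator_error_of_quadratic_modulus\<close>, \<open>mean_square_factor_tendsto_0\<close>). The weighted norm
  of the error is therefore eventually as small as desired.

  The estimate of \<open>f\<close> is where the limit of \<open>f / rho\<close> at infinity enters
  (\<open>C_rho_star_quadratic_modulus\<close>): this quotient is a continuous function of \<open>x / (1 + x)\<close>
  on the compact interval \<open>[0,1]\<close>, and the squared distance of \<open>t\<close> and \<open>x\<close> in the new variable is at most
  \<open>(t - x)\<^sup>2 / (1 + x\<^sup>2)\<close>, which cancels the weight.

  The moments of \<open>L\<close> come from two classical distributions. The Baskakov weights are the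
  negative binomial probabilities, and the Szasz weights are Erlang densities in \<open>t\<close> up to the factor
  \<open>n + p\<close>.
\<close>

section \<open>Quadratic modulus of continuity in the weighted space\<close>

text \<open>
  The substitution \<open>y = x / (1 + x)\<close> identifies \<open>[0,\<infinity>]\<close> with the compact interval \<open>[0,1]\<close>; a limit at
  infinity is exactly what is needed to extend \<open>h\<close> continuously to the endpoint.
\<close>

lemma continuous_on_compactified_half_line:
  fixes h :: "real \<Rightarrow> real"
  assumes cont: "continuous_on {0..} h" and lim: "(h \<longlongrightarrow> l) at_top"
  shows "continuous_on {0..1} (\<lambda>y. if y = 1 then l else h (y / (1 - y)))"
    (is "continuous_on _ ?\<phi>")
proof (rule continuous_on_eq_continuous_within[THEN iffD2], rule ballI)
  fix y :: real assume y: "y \<in> {0..1}"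
  show "continuous (at y within {0..1}) ?\<phi>"
  proof (cases "y = 1")
    case True
    have "filterlim (\<lambda>y::real. y / (1 - y)) at_top (at_left 1)"
      by real_asymp
    then have "((\<lambda>y. h (y / (1 - y))) \<longlongrightarrow> l) (at_left 1)"
      by (rule filterlim_compose[OF lim])
    moreover have "eventually (\<lambda>y. h (y / (1 - y)) = ?\<phi> y) (at_left 1)"
      by (auto simp: eventually_at_filter)
    ultimately have "(?\<phi> \<longlongrightarrow> l) (at_left 1)"
      by (rule Lim_transform_eventually)
    then have "(?\<phi> \<longlongrightarrow> l) (at 1 within {0..1})"
      by (simp add: at_within_Icc_at_left)
    then show ?thesis
      using True by (simp add: continuous_within)
  next
    case False
    have "continuous_on {0..<1} (\<lambda>y. h (y / (1 - y)))"
      by (rule continuous_on_compose2[OF cont]) (auto intro!: continuous_intros)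
    then have "continuous_on {0..<1} ?\<phi>"
      by (rule continuous_on_eq) auto
    then have "continuous (at y within {0..<1}) ?\<phi>"
      using False y by (auto simp: continuous_on_eq_continuous_within)
    moreover have "at y within {0..<1} = at y within {0..1}"
      using False y by (intro at_within_nhd[where S = "{..<1}"]) auto
    ultimately show ?thesis by simp
  qed
qed

text \<open>
  For nearby points uniform continuity gives \<open>\<epsilon>\<close>; for points at distance at least \<open>\<delta>\<close> the quadratic
  term is at least the total oscillation.
\<close>

lemma uniformly_continuous_quadratic_bound:
  fixes \<phi> :: "real \<Rightarrow> real"
  assumes cont: "continuous_on S \<phi>" and "compact S" and "\<epsilon> > 0"
  obtains C where "C \<ge> 0" "\<And>u v. u \<in> S \<Longrightarrow> v \<in> S \<Longrightarrow> \<bar>\<phi> u - \<phi> v\<bar> \<le> \<epsilon> + C * (u - v)\<^sup>2"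
proof -
  have "uniformly_continuous_on S \<phi>"
    using assms compact_uniformly_continuous by blast
  then obtain \<delta> where \<delta>: "\<delta> > 0" "\<And>u v. u \<in> S \<Longrightarrow> v \<in> S \<Longrightarrow> \<bar>u - v\<bar> < \<delta> \<Longrightarrow> \<bar>\<phi> u - \<phi> v\<bar> < \<epsilon>"
    using \<open>\<epsilon> > 0\<close> unfolding uniformly_continuous_on_def dist_real_def by metis
  have "bounded (\<phi> ` S)"
    using assms compact_continuous_image compact_imp_bounded by blast
  then obtain M where M: "M > 0" "\<And>u. u \<in> S \<Longrightarrow> \<bar>\<phi> u\<bar> \<le> M"
    by (auto simp: bounded_pos)
  show thesis
  proof (rule that[of "2 * M / \<delta>\<^sup>2"])
    show "2 * M / \<delta>\<^sup>2 \<ge> 0"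
      using M by simp
    fix u v assume uv: "u \<in> S" "v \<in> S"
    show "\<bar>\<phi> u - \<phi> v\<bar> \<le> \<epsilon> + 2 * M / \<delta>\<^sup>2 * (u - v)\<^sup>2"
    proof (cases "\<bar>u - v\<bar> < \<delta>")
      case True
      have "0 \<le> 2 * M / \<delta>\<^sup>2 * (u - v)\<^sup>2" using M by simp
      then show ?thesis using \<delta>(2)[OF uv True] by linarith
    next
      case False
      then have "\<delta>\<^sup>2 \<le> (u - v)\<^sup>2"
        using \<delta>(1) by (metis abs_le_square_iff abs_of_pos not_less)
      then have "2 * M \<le> 2 * M / \<delta>\<^sup>2 * (u - v)\<^sup>2"
        using \<delta>(1) M(1) by (simp add: field_simps)
      then show ?thesis using M(2)[OF uv(1)] M(2)[OF uv(2)] \<open>\<epsilon> > 0\<close> by linarith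
    qed
  qed
qed

text \<open>
  The distance in the compactified variable is \<open>\<bar>t - x\<bar> / ((1 + t) * (1 + x))\<close>. This decay in
  \<open>x\<close> compensates the weight.
\<close>

lemma compactified_sq_dist_le:
  fixes t x :: real
  assumes "t \<ge> 0" "x \<ge> 0"
  shows "(t / (1 + t) - x / (1 + x))\<^sup>2 * (1 + x\<^sup>2) \<le> (t - x)\<^sup>2"
proof -
  have eq: "t / (1 + t) - x / (1 + x) = (t - x) / ((1 + t) * (1 + x))"
    using assms by (simp add: divide_simps) (simp add: algebra_simps)
  have "1 + x\<^sup>2 \<le> (1 + x)\<^sup>2"
    using assms by (simp add: power2_eq_square algebra_simps)
  also have "\<dots> \<le> (1 + t)\<^sup>2 * (1 + x)\<^sup>2"
    using assms by (simp add: mult_le_cancel_right1)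
  finally have "(t - x)\<^sup>2 * (1 + x\<^sup>2) \<le> (t - x)\<^sup>2 * ((1 + t) * (1 + x))\<^sup>2"
    by (simp add: mult_left_mono power_mult_distrib)
  then show ?thesis
    unfolding eq power_divide using assms by (simp add: divide_le_eq)
qed

text \<open>
  A Korovkin-type estimate adapted to the weight: the error is measured relative to \<open>1 + x\<^sup>2\<close>, while the
  constant \<open>K\<close> of the quadratic term is uniform in \<open>x\<close>. Write \<open>f = h * rho\<close>. In
  \<open>f t - f x = h t * (t\<^sup>2 - x\<^sup>2) + (h t - h x) * (1 + x\<^sup>2)\<close> the first summand is controlled by the
  boundedness of \<open>h\<close>, the second by uniform continuity of \<open>h\<close> in the compactified variable.
  An estimate of \<open>\<bar>h t - h x\<bar>\<close> by \<open>\<epsilon> + C * (t - x)\<^sup>2\<close> would not suffice: multiplied by \<open>1 + x\<^sup>2\<close>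
  it yields a term that grows like \<open>x ^ 4\<close> under the operator.
\<close>

lemma C_rho_star_quadratic_modulus:
  assumes f: "f \<in> C_rho_star" and "\<epsilon> > 0"
  obtains K where "K \<ge> 0"
    "\<And>t x. t \<ge> 0 \<Longrightarrow> x \<ge> 0 \<Longrightarrow> \<bar>f t - f x\<bar> \<le> \<epsilon> * (1 + x\<^sup>2) + K * (t - x)\<^sup>2"
proof -
  define h where "h = (\<lambda>x. f x / rho x)"
  have rho_pos: "rho x > 0" for x
    unfolding rho_def by (simp add: add_pos_nonneg)
  have "\<exists>M0. \<forall>x\<ge>0. \<bar>f x\<bar> \<le> M0 * rho x" "continuous_on {0..} f"
    using f by (auto simp: C_rho_star_def C_rho_def)
  then obtain M0 where M0: "\<And>x. x \<ge> 0 \<Longrightarrow> \<bar>f x\<bar> \<le> M0 * rho x" and cf: "continuous_on {0..} f"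
    by blast
  define M where "M = max M0 1"
  have M: "M > 0" and hM: "\<And>x. x \<ge> 0 \<Longrightarrow> \<bar>h x\<bar> \<le> M"
    using M0 rho_pos by (auto simp: M_def h_def pos_divide_le_eq le_max_iff_disj abs_of_pos)
  obtain l where l: "(h \<longlongrightarrow> l) at_top"
    using f by (auto simp: C_rho_star_def h_def)
  have ch: "continuous_on {0..} h"
    unfolding h_def using rho_pos
    by (intro continuous_on_divide cf) (auto simp: rho_def
      intro!: continuous_intros, metis less_numeral_extra(3) rho_def)
  define \<phi> where "\<phi> = (\<lambda>y. if y = 1 then l else h (y / (1 - y)))"
  have "continuous_on {0..1} \<phi>"
    unfolding \<phi>_def by (rule continuous_on_compactified_half_line[OF ch l])
  then obtain C where C: "C \<ge> 0"
    "\<And>u v. u \<in> {0..1} \<Longrightarrow> v \<in> {0..1} \<Longrightarrow> \<bar>\<phi> u - \<phi> v\<bar> \<le> \<epsilon> / 2 + C * (u - v)\<^sup>2"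
    using uniformly_continuous_quadratic_bound[of "{0..1}" \<phi> "\<epsilon> / 2"] \<open>\<epsilon> > 0\<close> by auto
  have h_\<phi>: "h t = \<phi> (t / (1 + t))" if "t \<ge> 0" for t
  proof -
    have "t / (1 + t) / (1 - t / (1 + t)) = t"
      using that by (simp add: divide_simps)
    then show ?thesis using that by (auto simp: \<phi>_def)
  qed
  show thesis
  proof (rule that[of "C + M + 2 * M\<^sup>2 / \<epsilon>"])
    show "C + M + 2 * M\<^sup>2 / \<epsilon> \<ge> 0"
      using C M \<open>\<epsilon> > 0\<close> by simp
    fix t x :: real assume tx: "t \<ge> 0" "x \<ge> 0"
    define D where "D = (t - x)\<^sup>2"
    define s where "s = \<bar>t - x\<bar>"
    have D_s: "D = s\<^sup>2" by (simp add: D_def s_def)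
    define u v where "u = t / (1 + t)" and "v = x / (1 + x)"
    have "\<bar>h t - h x\<bar> \<le> \<epsilon> / 2 + C * (u - v)\<^sup>2"
      using C(2)[of u v] tx by (simp add: h_\<phi> u_def v_def)
    then have "\<bar>h t - h x\<bar> * (1 + x\<^sup>2) \<le> (\<epsilon> / 2 + C * (u - v)\<^sup>2) * (1 + x\<^sup>2)"
      by (rule mult_right_mono) simp
    also have "\<dots> = \<epsilon> / 2 * (1 + x\<^sup>2) + C * ((u - v)\<^sup>2 * (1 + x\<^sup>2))"
      by (simp add: algebra_simps)
    also have "\<dots> \<le> \<epsilon> / 2 * (1 + x\<^sup>2) + C * D"
      using compactified_sq_dist_le[OF tx] C(1) unfolding u_def v_def D_def
      by (intro add_left_mono mult_left_mono)
    finally have 1: "\<bar>(h t - h x) * (1 + x\<^sup>2)\<bar> \<le> \<epsilon> / 2 * (1 + x\<^sup>2) + C * D"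
      by (simp add: abs_mult)
    have "t\<^sup>2 - x\<^sup>2 = D + 2 * x * (t - x)"
      by (simp add: D_def power2_eq_square algebra_simps)
    then have "\<bar>t\<^sup>2 - x\<^sup>2\<bar> \<le> D + 2 * x * s"
      using tx abs_triangle_ineq[of D "2 * x * (t - x)"] by (simp add: D_def s_def abs_mult)
    (* Young's inequality, with the weight for which the x^2 term has coefficient \<epsilon> / 2 *)
    moreover have "M * (2 * x * s) \<le> \<epsilon> / 2 * x\<^sup>2 + 2 * M\<^sup>2 / \<epsilon> * D"
    proof -
      have "0 \<le> (\<epsilon> * x - 2 * M * s)\<^sup>2" by simp
      also have "\<dots> = 2 * \<epsilon> * (\<epsilon> / 2 * x\<^sup>2 + 2 * M\<^sup>2 / \<epsilon> * D - M * (2 * x * s))"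
        unfolding D_s using \<open>\<epsilon> > 0\<close> by (simp add: power2_eq_square field_simps)
      finally show ?thesis using \<open>\<epsilon> > 0\<close> by (simp add: zero_le_mult_iff)
    qed
    moreover have "\<bar>h t * (t\<^sup>2 - x\<^sup>2)\<bar> \<le> M * \<bar>t\<^sup>2 - x\<^sup>2\<bar>"
      using hM[OF tx(1)] by (simp add: abs_mult mult_right_mono)
    moreover have "M * \<bar>t\<^sup>2 - x\<^sup>2\<bar> \<le> M * (D + 2 * x * s)"
      using calculation(1) M by simp
    ultimately have 2: "\<bar>h t * (t\<^sup>2 - x\<^sup>2)\<bar> \<le> \<epsilon> / 2 * x\<^sup>2 + (M + 2 * M\<^sup>2 / \<epsilon>) * D"
      by (simp add: algebra_simps)
    have f_h: "f y = h y * (1 + y\<^sup>2)" for y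
      using rho_pos[of y] by (simp add: h_def rho_def)
    have "f t - f x = h t * (t\<^sup>2 - x\<^sup>2) + (h t - h x) * (1 + x\<^sup>2)"
      by (simp add: f_h algebra_simps)
    then have "\<bar>f t - f x\<bar> \<le> \<bar>h t * (t\<^sup>2 - x\<^sup>2)\<bar> + \<bar>(h t - h x) * (1 + x\<^sup>2)\<bar>"
      by simp
    also have "\<dots> \<le> \<epsilon> / 2 * x\<^sup>2 + (M + 2 * M\<^sup>2 / \<epsilon>) * D + (\<epsilon> / 2 * (1 + x\<^sup>2) + C * D)"
      using 1 2 by linarith
    also have "\<dots> \<le> \<epsilon> * (1 + x\<^sup>2) + (C + M + 2 * M\<^sup>2 / \<epsilon>) * D"
      using \<open>\<epsilon> > 0\<close> by (simp add: algebra_simps)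
    finally show "\<bar>f t - f x\<bar> \<le> \<epsilon> * (1 + x\<^sup>2) + (C + M + 2 * M\<^sup>2 / \<epsilon>) * (t - x)\<^sup>2"
      unfolding D_def .
  qed
qed

section \<open>Moments of the Baskakov weights\<close>

lemma baskakov_basis_nonneg: "x \<ge> 0 \<Longrightarrow> baskakov_basis n p k x \<ge> 0"
  by (simp add: baskakov_basis_def)

text \<open>
  With \<open>z = x / (1 + x)\<close> this is the binomial series of \<open>(1 - z) powr (- (n + p))\<close>, whose value
  \<open>(1 + x) ^ (n + p)\<close> cancels the remaining part of the denominator.
\<close>

lemma baskakov_basis_sums_1:
  assumes x: "x \<ge> 0" and N: "n + p \<ge> 1"
  shows "(\<lambda>k. baskakov_basis n p k x) sums 1"
proof -
  define N where "N = n + p"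
  define z where "z = x / (1 + x)"
  have z: "\<bar>- z\<bar> < 1" and z1: "1 - z = 1 / (1 + x)"
    using x by (auto simp: z_def field_simps)
  have "(\<lambda>k. (- real N gchoose k) * (- z) ^ k) sums (1 + - z) powr (- real N)"
    by (rule gen_binomial_real[OF z])
  also have "(1 + - z) powr (- real N) = (1 + x) ^ N"
    using x by (simp add: z1 powr_minus powr_realpow[symmetric] powr_divide)
  finally have "(\<lambda>k. (- real N gchoose k) * (- z) ^ k * (1 / (1 + x) ^ N)) sums
      ((1 + x) ^ N * (1 / (1 + x) ^ N))"
    by (rule sums_mult2)
  moreover have "(- real N gchoose k) * (- z) ^ k * (1 / (1 + x) ^ N) = baskakov_basis n p k x" for k
  proof -
    have "real k + real N - 1 = real (N + k - 1)"
      using N by (simp add: N_def)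
    then have "(- real N gchoose k) = (-1) ^ k * real ((N + k - 1) choose k)"
      by (simp add: gbinomial_negated_upper[of "- real N" k] binomial_gbinomial)
    moreover have "(- z) ^ k = (-1) ^ k * z ^ k"
      by (rule power_minus)
    ultimately show ?thesis
      by (simp add: baskakov_basis_def z_def N_def power_divide power_add mult_ac
          flip: power_mult_distrib)
  qed
  ultimately show ?thesis
    using x by simp
qed

text \<open>
  Raising the parameter \<open>n\<close> by one absorbs a factor \<open>k\<close>, so all moments of the weights
  follow from the normalisation with larger parameters.
\<close>

lemma baskakov_basis_absorb:
  "real (Suc k) * baskakov_basis n p (Suc k) x =
    real (n + p) * x * baskakov_basis (Suc n) p k x"
proof -
  have "Suc k * ((n + p + k) choose Suc k) = (n + p) * ((n + p + k) choose k)"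
    by (metis Suc_times_binomial_add add.commute add_Suc_right binomial_absorb_comp
        binomial_absorption add_diff_cancel_right' diff_Suc_1)
  then have "real (Suc k) * real ((n + p + k) choose Suc k) = real (n + p) * real ((n + p + k) choose k)"
    by (metis of_nat_mult)
  then show ?thesis
    by (simp add: baskakov_basis_def mult.assoc[symmetric])
qed

lemma baskakov_basis_first_moment:
  assumes x: "x \<ge> 0"
  shows "(\<lambda>k. real k * baskakov_basis n p k x) sums (real (n + p) * x)"
proof -
  have "(\<lambda>k. real (n + p) * x * baskakov_basis (Suc n) p k x) sums (real (n + p) * x * 1)"
    by (intro sums_mult baskakov_basis_sums_1) (use x in auto)
  then have "(\<lambda>k. real (Suc k) * baskakov_basis n p (Suc k) x) sums (real (n + p) * x)"
    unfolding baskakov_basis_absorb by simp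
  then show ?thesis
    by (subst (asm) sums_Suc_iff) simp
qed

lemma baskakov_basis_second_factorial_moment:
  assumes x: "x \<ge> 0"
  shows "(\<lambda>k. real k * (real k - 1) * baskakov_basis n p k x) sums
    (real (n + p) * (real (n + p) + 1) * x\<^sup>2)"
proof -
  have "(\<lambda>k. real (n + p) * x * (real k * baskakov_basis (Suc n) p k x)) sums
      (real (n + p) * x * (real (Suc n + p) * x))"
    by (intro sums_mult baskakov_basis_first_moment) (use x in auto)
  moreover have "real (n + p) * x * (real k * baskakov_basis (Suc n) p k x) =
      real (Suc k) * (real (Suc k) - 1) * baskakov_basis n p (Suc k) x" for k
    using baskakov_basis_absorb[of k n p x] by (simp add: mult_ac)
  ultimately have "(\<lambda>k. real (Suc k) * (real (Suc k) - 1) * baskakov_basis n p (Suc k) x) sums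
      (real (n + p) * (real (n + p) + 1) * x\<^sup>2)"
    by (simp add: power2_eq_square algebra_simps)
  then show ?thesis
    by (subst (asm) sums_Suc_iff) simp
qed

section \<open>Moments of the Szasz weights\<close>

abbreviation erlang_measure :: "nat \<Rightarrow> real \<Rightarrow> real measure" where
  "erlang_measure k l \<equiv> density lborel (erlang_density k l)"

text \<open>
  Up to the factor \<open>n + p\<close>, the Szasz weights are the densities of Erlang distributions, whose
  moments are known. The argument \<open>max 0 t\<close> replaces \<open>t\<close> because \<open>g\<close> is only controlled on the half-line:
  the modified integrand is continuous, hence measurable, on the whole line and agrees with \<open>g\<close> where
  the density lives.
\<close>

lemma szasz_integral_eq_expectation:
  assumes N: "n + p \<ge> 1" and g: "continuous_on {0..} g"
  shows "real (n + p) * (LINT t:{0..}|lborel. szasz_basis n p k t * g t) =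
    (LINT t|erlang_measure k (real (n + p)). g (max 0 t))"
proof -
  have "continuous_on UNIV (\<lambda>t. g (max 0 t))"
    by (rule continuous_on_compose2[OF g]) (auto intro!: continuous_intros)
  then have meas: "(\<lambda>t. g (max 0 t)) \<in> borel_measurable borel"
    by (rule borel_measurable_continuous_onI)
  have "(LINT t|erlang_measure k (real (n + p)). g (max 0 t)) =
      (LINT t|lborel. erlang_density k (real (n + p)) t * g (max 0 t))"
    using meas N by (subst integral_density) auto
  also have "\<dots> = (LINT t|lborel. real (n + p) * (indicator {0..} t * (szasz_basis n p k t * g t)))"
    by (intro Bochner_Integration.integral_cong)
      (auto simp: erlang_density_def szasz_basis_def power_mult_distrib indicator_def
        simp del: of_nat_add)
  finally show ?thesis
    by (simp add: set_lebesgue_integral_def)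
qed

lemma erlang_measure_moment:
  assumes l: "l > 0"
  shows "has_bochner_integral (erlang_measure k l) (\<lambda>t. max 0 t ^ i) (fact (k + i) / (fact k * l ^ i))"
proof (rule has_bochner_integral_nn_integral)
  have "(\<integral>\<^sup>+ t. ennreal (max 0 t ^ i) \<partial>erlang_measure k l) =
      (\<integral>\<^sup>+ t. ennreal (erlang_density k l t * t ^ i) \<partial>lborel)"
    using l by (subst nn_integral_density)
      (auto intro!: nn_integral_cong simp: erlang_density_def ennreal_mult' max_def)
  then show "(\<integral>\<^sup>+ t. ennreal (max 0 t ^ i) \<partial>erlang_measure k l) =
      ennreal (fact (k + i) / (fact k * l ^ i))"
    by (simp only: nn_integral_erlang_ith_moment[OF l])
qed (use l in auto)

text \<open>
  Besides the estimate itself, the growth bound is what makes \<open>g\<close> integrable; without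
  integrability the constant \<open>c\<close> could not be moved into the integral.
\<close>

lemma erlang_measure_expectation_bound:
  assumes l: "l > 0" and g: "continuous_on {0..} g"
    and bound: "\<And>t. t \<ge> 0 \<Longrightarrow> \<bar>g t - c\<bar> \<le> A + B * t + C * t\<^sup>2"
  shows "\<bar>(LINT t|erlang_measure k l. g (max 0 t)) - c\<bar> \<le>
    A + B * ((real k + 1) / l) + C * ((real k + 1) * (real k + 2) / l\<^sup>2)"
proof -
  let ?D = "erlang_measure k l" and ?q = "\<lambda>t. A + B * max 0 t + C * (max 0 t)\<^sup>2"
  interpret prob_space ?D
    by (rule prob_space_erlang_density[OF l])
  have m1: "has_bochner_integral ?D (\<lambda>t. max 0 t) ((real k + 1) / l)"
    using erlang_measure_moment[OF l, of k 1] by (simp add: add.commute)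
  have "fact (k + 2) / (fact k * l ^ 2) = (real k + 1) * (real k + 2) / l\<^sup>2"
    by (simp add: mult_ac add.commute)
  then have m2: "has_bochner_integral ?D (\<lambda>t. (max 0 t)\<^sup>2) ((real k + 1) * (real k + 2) / l\<^sup>2)"
    using erlang_measure_moment[OF l, of k 2] by (simp only:)
  have "has_bochner_integral ?D (\<lambda>t. A) A"
    using prob_space by (simp add: has_bochner_integral_iff)
  then have q: "has_bochner_integral ?D ?q
      (A + B * ((real k + 1) / l) + C * ((real k + 1) * (real k + 2) / l\<^sup>2))"
    by (intro has_bochner_integral_add has_bochner_integral_mult_right m1 m2)
  have "continuous_on UNIV (\<lambda>t. g (max 0 t))"
    by (rule continuous_on_compose2[OF g]) (auto intro!: continuous_intros)
  then have meas: "(\<lambda>t. g (max 0 t)) \<in> borel_measurable ?D"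
    by (simp add: borel_measurable_continuous_onI)
  have int: "integrable ?D (\<lambda>t. g (max 0 t) - c)"
  proof (rule Bochner_Integration.integrable_bound)
    show "integrable ?D ?q" using q by (rule integrable.intros)
    show "AE t in ?D. norm (g (max 0 t) - c) \<le> norm (?q t)"
      by (rule AE_I2, unfold real_norm_def, rule order_trans[OF bound abs_ge_self]) simp
  qed (use meas in measurable)
  then have int_g: "integrable ?D (\<lambda>t. g (max 0 t))"
    using Bochner_Integration.integrable_add[OF int, of "\<lambda>_. c"] by simp
  have "(LINT t|?D. g (max 0 t)) - c = (LINT t|?D. g (max 0 t) - c)"
    using int_g prob_space by simp
  also have "\<bar>\<dots>\<bar> \<le> (LINT t|?D. \<bar>g (max 0 t) - c\<bar>)"
    by (rule integral_abs_bound)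
  also have "\<dots> \<le> (LINT t|?D. ?q t)"
    using int integrable.intros[OF q] by (intro integral_mono bound) auto
  finally show ?thesis
    using has_bochner_integral_integral_eq[OF q] by simp
qed

section \<open>Pointwise error of the operator\<close>

text \<open>
  Positivity and the normalisation of the operator: \<open>c\<close> may be moved inside, and an error that is
  bounded by a quadratic polynomial in \<open>t\<close> is transformed into the same combination of the moments
  of \<open>1\<close>, \<open>t\<close> and \<open>t\<^sup>2\<close>. The bound serves for convergence of the series as well.
\<close>

lemma BSSS_operator_error:
  assumes N: "n + p \<ge> 1" and "0 \<le> \<alpha>" "0 \<le> \<beta>" and x: "x \<ge> 0" and f: "continuous_on {0..} f"
    and bound: "\<And>t. t \<ge> 0 \<Longrightarrow>
      \<bar>f ((real n * t + \<alpha>) / (real n + \<beta>)) - c\<bar> \<le> A + B * t + C * t\<^sup>2"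
  defines "l \<equiv> real (n + p)"
  shows "\<bar>BSSS_operator \<alpha> \<beta> n p f x - c\<bar> \<le>
    A + B * (x + 1 / l) + C * ((1 + 1 / l) * x\<^sup>2 + 4 * x / l + 2 / l\<^sup>2)"
proof -
  have l: "l > 0" using N by (simp add: l_def)
  define g where "g = (\<lambda>t. f ((real n * t + \<alpha>) / (real n + \<beta>)))"
  have g: "continuous_on {0..} g"
    unfolding g_def using assms(2,3)
    by (cases "real n + \<beta> = 0") (auto intro!: continuous_on_compose2[OF f] continuous_intros)
  define b where "b = (\<lambda>k. baskakov_basis n p k x)"
  define J where "J = (\<lambda>k. LINT t:{0..}|lborel. szasz_basis n p k t * g t)"
  define q where "q = (\<lambda>k. A + B * ((real k + 1) / l) + C * ((real k + 1) * (real k + 2) / l\<^sup>2))"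
  have b0: "b k \<ge> 0" for k
    using x by (simp add: b_def baskakov_basis_nonneg)
  have J: "\<bar>l * J k - c\<bar> \<le> q k" for k
    using erlang_measure_expectation_bound[OF l g, of c A B C k] bound
      szasz_integral_eq_expectation[OF N g, of k]
    by (simp add: g_def J_def q_def l_def)
  (* (k + 1) (k + 2) = k (k - 1) + 4 k + 2 expresses the summands by factorial moments. *)
  have "(\<lambda>k. (A + B / l + 2 * C / l\<^sup>2) * b k + (B / l + 4 * C / l\<^sup>2) * (real k * b k) +
      C / l\<^sup>2 * (real k * (real k - 1) * b k)) sums
    ((A + B / l + 2 * C / l\<^sup>2) * 1 + (B / l + 4 * C / l\<^sup>2) * (l * x) + C / l\<^sup>2 * (l * (l + 1) * x\<^sup>2))"
    unfolding b_def l_def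
    by (intro sums_add sums_mult baskakov_basis_sums_1 baskakov_basis_first_moment
        baskakov_basis_second_factorial_moment x N)
  moreover have "(A + B / l + 2 * C / l\<^sup>2) * b k + (B / l + 4 * C / l\<^sup>2) * (real k * b k) +
      C / l\<^sup>2 * (real k * (real k - 1) * b k) = b k * q k" for k
    using l by (simp add: q_def field_simps power2_eq_square)
  moreover have "(A + B / l + 2 * C / l\<^sup>2) * 1 + (B / l + 4 * C / l\<^sup>2) * (l * x) + C / l\<^sup>2 * (l * (l + 1) * x\<^sup>2)
      = A + B * (x + 1 / l) + C * ((1 + 1 / l) * x\<^sup>2 + 4 * x / l + 2 / l\<^sup>2)"
    using l by (simp add: field_simps power2_eq_square)
  ultimately have bq: "(\<lambda>k. b k * q k) sums
      (A + B * (x + 1 / l) + C * ((1 + 1 / l) * x\<^sup>2 + 4 * x / l + 2 / l\<^sup>2))"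
    by (simp only:)
  have le: "norm (b k * (l * J k - c)) \<le> b k * q k" for k
    using J[of k] b0[of k] by (simp add: abs_mult mult_left_mono)
  have summ: "summable (\<lambda>k. b k * (l * J k - c))"
    by (rule summable_comparison_test'[OF sums_summable[OF bq]]) (rule le)
  have bs: "b sums 1"
    unfolding b_def by (rule baskakov_basis_sums_1[OF x N])
  have "(\<lambda>k. (b k * (l * J k - c) + c * b k) / l) sums (((\<Sum>k. b k * (l * J k - c)) + c * 1) / l)"
    by (intro sums_divide sums_add sums_mult bs summable_sums summ)
  moreover have "(b k * (l * J k - c) + c * b k) / l = b k * J k" for k
    using l by (simp add: field_simps)
  ultimately have "(\<lambda>k. b k * J k) sums (((\<Sum>k. b k * (l * J k - c)) + c) / l)"
    by simp
  then have "(\<Sum>k. b k * J k) = ((\<Sum>k. b k * (l * J k - c)) + c) / l"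
    by (rule sums_unique[symmetric])
  moreover have "BSSS_operator \<alpha> \<beta> n p f x = l * (\<Sum>k. b k * J k)"
    unfolding BSSS_operator_def b_def J_def g_def l_def ..
  ultimately have "BSSS_operator \<alpha> \<beta> n p f x - c = (\<Sum>k. b k * (l * J k - c))"
    using l by simp
  also have "\<bar>\<dots>\<bar> \<le> (\<Sum>k. b k * q k)"
    using norm_suminf_le[OF le sums_summable[OF bq]] by simp
  finally show ?thesis
    using sums_unique[OF bq] by simp
qed

text \<open>
  The operator maps \<open>\<lambda>t. (t - x)\<^sup>2\<close>, evaluated at \<open>x\<close>, to a quadratic polynomial in \<open>x\<close>. The sum
  of the absolute values of its three coefficients bounds this polynomial relative to \<open>1 + x\<^sup>2\<close>,
  uniformly in \<open>x \<ge> 0\<close>.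
\<close>

definition mean_square_factor :: "real \<Rightarrow> real \<Rightarrow> nat \<Rightarrow> nat \<Rightarrow> real" where
  "mean_square_factor \<alpha> \<beta> p n = (let l = real (n + p); a = n / (n + \<beta>); b = \<alpha> / (n + \<beta>) in
    \<bar>a\<^sup>2 * (1 + 1 / l) - 2 * a + 1\<bar> + \<bar>4 * a\<^sup>2 / l + 2 * a * b - 2 * a / l - 2 * b\<bar> +
    \<bar>2 * a\<^sup>2 / l\<^sup>2 + 2 * a * b / l + b\<^sup>2\<bar>)"

lemma mean_square_factor_tendsto_0: "mean_square_factor \<alpha> \<beta> p \<longlonglongrightarrow> 0"
proof -
  have l: "(\<lambda>n. 1 / real (n + p)) \<longlonglongrightarrow> 0"
    by real_asymp
  have a: "(\<lambda>n. real n / (real n + \<beta>)) \<longlonglongrightarrow> 1"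
    by real_asymp
  have b: "(\<lambda>n. \<alpha> / (real n + \<beta>)) \<longlonglongrightarrow> 0"
    by real_asymp
  define F where "F = (\<lambda>a b m :: real. \<bar>a\<^sup>2 * (1 + m) - 2 * a + 1\<bar> +
    \<bar>4 * a\<^sup>2 * m + 2 * a * b - 2 * a * m - 2 * b\<bar> + \<bar>2 * a\<^sup>2 * m\<^sup>2 + 2 * a * b * m + b\<^sup>2\<bar>)"
  have "(\<lambda>n. F (real n / (real n + \<beta>)) (\<alpha> / (real n + \<beta>)) (1 / real (n + p))) \<longlonglongrightarrow> F 1 0 0"
    unfolding F_def by (intro tendsto_intros l a b)
  moreover have "mean_square_factor \<alpha> \<beta> p n =
      F (real n / (real n + \<beta>)) (\<alpha> / (real n + \<beta>)) (1 / real (n + p))" for n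
    by (simp add: mean_square_factor_def F_def Let_def power_divide mult_ac)
  moreover have "F 1 0 0 = 0"
    by (simp add: F_def)
  ultimately show ?thesis
    by (metis (no_types, lifting) ext)
qed

text \<open>
  The point \<open>(n * t + \<alpha>) / (n + \<beta>)\<close> is affine in \<open>t\<close>, so the modulus evaluated there is a quadratic
  polynomial in \<open>t\<close>. Collecting its image under the operator by powers of \<open>x\<close> exhibits the
  cancellation that makes the mean square small.
\<close>

lemma BSSS_operator_error_of_quadratic_modulus:
  assumes N: "n + p \<ge> 1" and "0 \<le> \<alpha>" "0 \<le> \<beta>" and x: "x \<ge> 0" and f: "continuous_on {0..} f"
    and "K \<ge> 0"
    and modulus: "\<And>t. t \<ge> 0 \<Longrightarrow> \<bar>f t - f x\<bar> \<le> \<epsilon> * (1 + x\<^sup>2) + K * (t - x)\<^sup>2"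
  shows "\<bar>BSSS_operator \<alpha> \<beta> n p f x - f x\<bar> \<le>
    (\<epsilon> + K * mean_square_factor \<alpha> \<beta> p n) * (1 + x\<^sup>2)"
proof -
  define l a b where "l = real (n + p)" and "a = n / (n + \<beta>)" and "b = \<alpha> / (n + \<beta>)"
  have ab: "a \<ge> 0" "b \<ge> 0"
    using assms(2,3) by (simp_all add: a_def b_def)
  have affine: "(real n * t + \<alpha>) / (real n + \<beta>) = a * t + b" for t
    by (simp add: a_def b_def add_divide_distrib)
  have "\<bar>f ((real n * t + \<alpha>) / (real n + \<beta>)) - f x\<bar> \<le>
      (\<epsilon> * (1 + x\<^sup>2) + K * (b - x)\<^sup>2) + (2 * K * a * (b - x)) * t + (K * a\<^sup>2) * t\<^sup>2" if "t \<ge> 0" for t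
    using modulus[of "a * t + b"] that ab
    unfolding affine by (simp add: power2_eq_square algebra_simps)
  from BSSS_operator_error[OF N assms(2,3) x f this]
  have "\<bar>BSSS_operator \<alpha> \<beta> n p f x - f x\<bar> \<le>
      (\<epsilon> * (1 + x\<^sup>2) + K * (b - x)\<^sup>2) + (2 * K * a * (b - x)) * (x + 1 / l) +
      (K * a\<^sup>2) * ((1 + 1 / l) * x\<^sup>2 + 4 * x / l + 2 / l\<^sup>2)"
    by (simp only: l_def)
  also have "\<dots> = \<epsilon> * (1 + x\<^sup>2) + K * ((a\<^sup>2 * (1 + 1 / l) - 2 * a + 1) * x\<^sup>2 +
      (4 * a\<^sup>2 / l + 2 * a * b - 2 * a / l - 2 * b) * x + (2 * a\<^sup>2 / l\<^sup>2 + 2 * a * b / l + b\<^sup>2))"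
    by (simp add: power2_eq_square algebra_simps)
  also have "\<dots> \<le> \<epsilon> * (1 + x\<^sup>2) + K * (mean_square_factor \<alpha> \<beta> p n * (1 + x\<^sup>2))"
  proof -
    have x_le: "\<bar>x\<bar> \<le> 1 + x\<^sup>2"
      using sum_squares_bound[of x 1] x zero_le_power2[of x] by simp
    have le: "u * y \<le> \<bar>u\<bar> * (1 + x\<^sup>2)" if "\<bar>y\<bar> \<le> 1 + x\<^sup>2" for u y
    proof -
      have "u * y \<le> \<bar>u\<bar> * \<bar>y\<bar>" by (metis abs_ge_self abs_mult)
      also have "\<dots> \<le> \<bar>u\<bar> * (1 + x\<^sup>2)" using that by (simp add: mult_left_mono)
      finally show ?thesis .
    qed
    have "u * x\<^sup>2 + v * x + w \<le> (\<bar>u\<bar> + \<bar>v\<bar> + \<bar>w\<bar>) * (1 + x\<^sup>2)" for u v w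
      using le[of "x\<^sup>2" u] le[OF x_le, of v] le[of 1 w] by (simp add: distrib_right)
    then show ?thesis
      using \<open>K \<ge> 0\<close> unfolding mean_square_factor_def Let_def l_def[symmetric] a_def[symmetric] b_def[symmetric]
      by (intro add_left_mono mult_left_mono)
  qed
  finally show ?thesis
    by (simp add: algebra_simps)
qed

section \<open>Convergence in the weighted norm\<close>

theorem theorem7:
  fixes p :: nat and \<alpha> \<beta> :: real and f :: "real \<Rightarrow> real"
  assumes "p \<ge> 1" and "0 \<le> \<alpha>" and "\<alpha> \<le> \<beta>"
    and "f \<in> C_rho_star"
  shows "(\<lambda>n. rho_norm (\<lambda>x. BSSS_operator \<alpha> \<beta> n p f x - f x)) \<longlonglongrightarrow> 0"
proof (rule order_tendstoI)
  fix y :: ereal assume "y < 0"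
  have "0 \<le> rho_norm g" for g
    unfolding rho_norm_def by (rule SUP_upper2[of 0]) auto
  then show "\<forall>\<^sub>F n in sequentially. y < rho_norm (\<lambda>x. BSSS_operator \<alpha> \<beta> n p f x - f x)"
    by (intro always_eventually allI less_le_trans[OF \<open>y < 0\<close>])
next
  fix y :: ereal assume "0 < y"
  then obtain \<epsilon> where "0 < ereal \<epsilon>" and \<epsilon>_y: "ereal \<epsilon> < y"
    using ereal_dense2 by blast
  then have "\<epsilon> / 2 > 0" by simp
  then obtain K where "K \<ge> 0" and K: "\<And>t x. t \<ge> 0 \<Longrightarrow> x \<ge> 0 \<Longrightarrow>
      \<bar>f t - f x\<bar> \<le> \<epsilon> / 2 * (1 + x\<^sup>2) + K * (t - x)\<^sup>2"
    using C_rho_star_quadratic_modulus[OF assms(4)] by blast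
  have f: "continuous_on {0..} f"
    using assms(4) by (simp add: C_rho_star_def C_rho_def)
  have "(\<lambda>n. K * mean_square_factor \<alpha> \<beta> p n) \<longlonglongrightarrow> K * 0"
    by (intro tendsto_intros mean_square_factor_tendsto_0)
  then have "\<forall>\<^sub>F n in sequentially. K * mean_square_factor \<alpha> \<beta> p n < \<epsilon> / 2"
    by (rule order_tendstoD(2)) (use \<open>\<epsilon> / 2 > 0\<close> in simp)
  then show "\<forall>\<^sub>F n in sequentially. rho_norm (\<lambda>x. BSSS_operator \<alpha> \<beta> n p f x - f x) < y"
  proof eventually_elim
    case (elim n)
    have "\<bar>BSSS_operator \<alpha> \<beta> n p f x - f x\<bar> / (1 + x\<^sup>2) \<le> \<epsilon>" if "x \<ge> 0" for x
    proof -
      have "\<bar>BSSS_operator \<alpha> \<beta> n p f x - f x\<bar> \<le>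
          (\<epsilon> / 2 + K * mean_square_factor \<alpha> \<beta> p n) * (1 + x\<^sup>2)"
        using assms f K \<open>K \<ge> 0\<close> that by (intro BSSS_operator_error_of_quadratic_modulus) auto
      also have "\<dots> \<le> \<epsilon> * (1 + x\<^sup>2)"
        using elim by (intro mult_right_mono) auto
      finally show ?thesis
        by (simp add: pos_divide_le_eq add_pos_nonneg)
    qed
    then have "rho_norm (\<lambda>x. BSSS_operator \<alpha> \<beta> n p f x - f x) \<le> ereal \<epsilon>"
      unfolding rho_norm_def by (intro SUP_least) auto
    then show ?case
      using \<epsilon>_y by (rule le_less_trans)
  qed
qed

end
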